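(* Let $\mathcal K=(V,\mathcal S)$ be a finite simplicial complex satisfying the standing assumptions (bounded degree, finite dimension, pure, strongly connected), and let $n=\dim\mathcal K$. Let $D_n^{\mathrm{down}}:\ell^2(K_n)\to\ell^2(K_n)$ be the $n$-down discriminant. Then: (1) $D_n^{\mathrm{down}}$ has eigenvalue $1$ if and only if $\mathcal K$ is totally non-coherently orientable. (2) $D_n^{\mathrm{down}}$ has eigenvalue $-1$ if and only if $\mathcal K$ is coherently orientable.
   Context: Complexes. $\mathcal K=(V,\mathcal S)$ is an abstract simplicial complex: $V$ is a countable set, $\mathcal S$ is a family of finite subsets of $V$ closed under taking subsets, containing $\emptyset$ and all singletons. $\mathcal S_q$ is the set of simplices with $q+1$ elements (dimension $q$). Standing assumptions: (bounded degree) there is a constant $c$ such that every nonempty $F\in\mathcal S$ is contained in at most $c$ elements of $\mathcal S$; (finite dimension) $\dim\mathcal K:=\max\{\dim F: F\in\mathcal S\}<\infty$, and $\dim\mathcal K\ge 1$; (pure) every simplex is contained in a simplex of dimension $\dim\mathcal K$; (strongly connected) any two $\sigma_1,\sigma_2\in\mathcal S_{\dim\mathcal K}$ are joined by a sequence $\sigma_1=\tau_1,\dots,\tau_m=\sigma_2$ in $\mathcal S_{\dim\mathcal K}$ with $\tau_i\cap\tau_{i+1}\in\mathcal S_{\dim\mathcal K-1}$. Orientations. $\widehat K_q$ is the set of sequences $s=(a_0\cdots a_q)$ with $\{a_0,\dots,a_q\}\in\mathcal S_q$; $\mathfrak S_{q+1}$ acts by $s^\pi=(a_{\pi(0)}\cdots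 a_{\pi(q)})$. For $q\ge1$, $K_q=\widehat K_q/\mathfrak A_{q+1}$ (alternating group) is the set of oriented $q$-simplices; the class of $s$ is $\langle s\rangle$. Each $q$-simplex has two orientations, $\tau$ and its opposite $\overline\tau$. For $q=0$, $K_0=V\times\{\pm1\}$, $\langle (a)\rangle=(a,+1)$, $\overline{(a,\varepsilon)}=(a,-\varepsilon)$. $[\tau]\in\mathcal S_q$ denotes the underlying simplex of $\tau$. For $\sigma=\langle a_0\cdots a_q\rangle\in K_q$ and $\tau\in K_{q-1}$: $\mathrm{sgn}(\sigma,\tau)=(-1)^j$ if $\tau=\langle a_0\cdots\widehat{a_j}\cdots a_q\rangle$, $\mathrm{sgn}(\sigma,\tau)=-(-1)^j$ if $\overline\tau=\langle a_0\cdots\widehat{a_j}\cdots a_q\rangle$, and $\mathrm{sgn}(\sigma,\tau)=0$ if $[\tau]\not\subset[\sigma]$. Down discriminant. Distinct $[\tau_1],[\tau_2]\in\mathcal S_q$ ($q\ge1$) are down neighbors if $[\tau_1]\cap[\tau_2]\in\mathcal S_{q-1}$ (one also says $\tau_1,\tau_2\in K_q$ are down neighbors). $\deg_Y(\tau)$ is the number of $[\tau']\in\mathcal S_q$ that are down neighbors of $[\tau]$. If $q=\dim\mathcal K$ it is assumed that $\mathcal S_q$ has at least two elements, so that $\deg_Y(\tau)\ge1$ for all $\tau \in K_q$. For down neighbors put $\eta^{\mathrm{down}}(\tau_1,\tau_2)=\mathrm{sgn}(\tau_1,\mu)\,\mathrm{sgn}(\tau_2,\mu)$, where $\mu\in K_{q-1}$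 is either orientation of $[\tau_1]\cap[\tau_2]$. The down discriminant on $\ell^2(K_q)$ is $$(D_q^{\mathrm{down}}g)(\tau)=\sum_{\tau'\in K_q:\,[\tau'],[\tau]\text{ down neighbors}}\frac{\eta^{\mathrm{down}}(\tau,\tau')}{\sqrt{2\deg_Y(\tau)}\sqrt{2\deg_Y(\tau')}}\,g(\tau').$$ Orientability. An orientation of the $n$-dimensional complex $\mathcal K$ is a subset $K_n^o\subset K_n$ with $K_n^o\cap\overline{K_n^o}=\emptyset$ and $K_n=K_n^o\cup\overline{K_n^o}$, where $\overline{K_n^o}=\{\overline\sigma:\sigma\in K_n^o\}$. $\mathcal K$ is coherently orientable if there is an orientation $K_n^o$ such that $\mathrm{sgn}(\sigma_1,\tau)\,\mathrm{sgn}(\sigma_2,\tau)=-1$ for all down neighbors $\sigma_1,\sigma_2\in K_n^o$, where $[\tau]=[\sigma_1]\cap[\sigma_2]$ (either orientation $\tau$). It is totally non-coherently orientable if there is an orientation $K_n^o$ such that $\mathrm{sgn}(\sigma_1,\tau)\,\mathrm{sgn}(\sigma_2,\tau)=1$ for all such pairs. *)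

theory Defs
  imports "HOL-Analysis.Analysis" "HOL-Combinatorics.Combinatorics"
begin

definition q_simplices :: "'a set set \<Rightarrow> nat \<Rightarrow> 'a set set" where
  "q_simplices S q = {F \<in> S. card F = q + 1}"

(* The truncated subtraction only changes the dimension of the empty simplex from -1 to 0;
   this is immaterial for the maximum, since dimension at least 1 is required below. *)
definition complex_dim :: "'a set set \<Rightarrow> nat" where
  "complex_dim S = Max ((\<lambda>F. card F - 1) ` S)"

locale simplicial_complex =
  fixes V :: "'a set" and S :: "'a set set"
  assumes countable_vertices: "countable V"
    and simplex_subset: "F \<in> S \<Longrightarrow> finite F \<and> F \<subseteq> V"
    and down_closed: "F \<in> S \<Longrightarrow> G \<subseteq> F \<Longrightarrow> G \<in> S"
    and empty_simplex: "{} \<in> S"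
    and singleton_simplex: "a \<in> V \<Longrightarrow> {a} \<in> S"

locale standing_complex = simplicial_complex V S
  for V :: "'a set" and S :: "'a set set" +
  assumes bounded_degree:
      "\<exists>c::nat. \<forall>F\<in>S. F \<noteq> {} \<longrightarrow> finite {G \<in> S. F \<subseteq> G} \<and> card {G \<in> S. F \<subseteq> G} \<le> c"
    and finite_dim: "finite ((\<lambda>F. card F - 1) ` S)"
    and dim_ge_1: "complex_dim S \<ge> 1"
    and pure: "F \<in> S \<Longrightarrow> \<exists>G \<in> q_simplices S (complex_dim S). F \<subseteq> G"
    and strongly_connected:
      "\<lbrakk>F \<in> q_simplices S (complex_dim S); G \<in> q_simplices S (complex_dim S)\<rbrakk> \<Longrightarrow>
       \<exists>ts. ts \<noteq> [] \<and> hd ts = F \<and> last ts = G \<and> set ts \<subseteq> q_simplices S (complex_dim S) \<and>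
            successively (\<lambda>A B. A \<inter> B \<in> q_simplices S (complex_dim S - 1)) ts"

(* An oriented vertex is a vertex with a sign; an oriented simplex of dimension at least 1 is an
   orbit of vertex sequences under even permutations. *)
datatype 'a oriented_simplex = Oriented_Vertex 'a int | Oriented_Class "'a list set"

definition vertex_sequences :: "'a set set \<Rightarrow> nat \<Rightarrow> 'a list set" where
  "vertex_sequences S q = {s. length s = q + 1 \<and> set s \<in> q_simplices S q}"

definition oriented_class :: "'a list \<Rightarrow> 'a oriented_simplex" where
  "oriented_class s =
     (if length s = 1 then Oriented_Vertex (hd s) 1
      else Oriented_Class {permute_list \<pi> s |\<pi>. \<pi> permutes {..<length s} \<and> evenperm \<pi>})"

definition oriented_simplices :: "'a set \<Rightarrow> 'a set set \<Rightarrow> nat \<Rightarrow> 'a oriented_simplex set" where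
  "oriented_simplices V S q =
     (if q = 0 then {Oriented_Vertex a e |a e. a \<in> V \<and> e \<in> {1, -1}}
      else oriented_class ` vertex_sequences S q)"

fun opposite :: "'a oriented_simplex \<Rightarrow> 'a oriented_simplex" where
  "opposite (Oriented_Vertex a e) = Oriented_Vertex a (- e)"
| "opposite (Oriented_Class C) =
     Oriented_Class {permute_list \<pi> s |\<pi> s. s \<in> C \<and> \<pi> permutes {..<length s} \<and> \<not> evenperm \<pi>}"

fun underlying :: "'a oriented_simplex \<Rightarrow> 'a set" where
  "underlying (Oriented_Vertex a e) = {a}"
| "underlying (Oriented_Class C) = (\<Union>s\<in>C. set s)"

(* Meant for \<sigma> of dimension q \<ge> 1 and \<tau> of dimension q - 1, where the value does not depend
   on the representative s of \<sigma>. *)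
definition incidence_sgn :: "'a oriented_simplex \<Rightarrow> 'a oriented_simplex \<Rightarrow> int" where
  "incidence_sgn \<sigma> \<tau> =
     (if underlying \<tau> \<subseteq> underlying \<sigma>
      then THE e. \<exists>s j. \<sigma> = oriented_class s \<and> j < length s \<and>
             (\<tau> = oriented_class (take j s @ drop (Suc j) s) \<and> e = (-1) ^ j \<or>
              opposite \<tau> = oriented_class (take j s @ drop (Suc j) s) \<and> e = - ((-1) ^ j))
      else 0)"

definition down_neighbors :: "'a set set \<Rightarrow> nat \<Rightarrow> 'a set \<Rightarrow> 'a set \<Rightarrow> bool" where
  "down_neighbors S q F G \<longleftrightarrow>
     F \<in> q_simplices S q \<and> G \<in> q_simplices S q \<and> F \<noteq> G \<and> F \<inter> G \<in> q_simplices S (q - 1)"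

definition down_degree :: "'a set set \<Rightarrow> nat \<Rightarrow> 'a oriented_simplex \<Rightarrow> nat" where
  "down_degree S q \<tau> = card {F \<in> q_simplices S q. down_neighbors S q F (underlying \<tau>)}"

(* Either orientation \<mu> of the common face gives the same value. *)
definition eta_down ::
  "'a set \<Rightarrow> 'a set set \<Rightarrow> nat \<Rightarrow> 'a oriented_simplex \<Rightarrow> 'a oriented_simplex \<Rightarrow> int" where
  "eta_down V S q \<tau>\<^sub>1 \<tau>\<^sub>2 =
     (let \<mu> = (SOME \<mu>. \<mu> \<in> oriented_simplices V S (q - 1) \<and>
                        underlying \<mu> = underlying \<tau>\<^sub>1 \<inter> underlying \<tau>\<^sub>2)
      in incidence_sgn \<tau>\<^sub>1 \<mu> * incidence_sgn \<tau>\<^sub>2 \<mu>)"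

(* Functions on X are represented by functions on the whole type that vanish outside X. *)
definition l2_space :: "'b set \<Rightarrow> ('b \<Rightarrow> complex) set" where
  "l2_space X = {g. (\<forall>x. x \<notin> X \<longrightarrow> g x = 0) \<and> (\<lambda>x. (cmod (g x))\<^sup>2) summable_on X}"

definition down_discriminant ::
  "'a set \<Rightarrow> 'a set set \<Rightarrow> nat \<Rightarrow> ('a oriented_simplex \<Rightarrow> complex) \<Rightarrow> 'a oriented_simplex \<Rightarrow> complex"
  where
  "down_discriminant V S q g \<tau> =
     (if \<tau> \<in> oriented_simplices V S q then
        (\<Sum>\<tau>' \<in> {\<tau>' \<in> oriented_simplices V S q. down_neighbors S q (underlying \<tau>') (underlying \<tau>)}.
           of_int (eta_down V S q \<tau> \<tau>') /
           of_real (sqrt (2 * real (down_degree S q \<tau>)) * sqrt (2 * real (down_degree S q \<tau>'))) *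
           g \<tau>')
      else 0)"

definition has_eigenvalue ::
  "('b \<Rightarrow> complex) set \<Rightarrow> (('b \<Rightarrow> complex) \<Rightarrow> 'b \<Rightarrow> complex) \<Rightarrow> complex \<Rightarrow> bool" where
  "has_eigenvalue H T c \<longleftrightarrow> (\<exists>g\<in>H. g \<noteq> (\<lambda>x. 0) \<and> T g = (\<lambda>x. c * g x))"

definition complex_orientation ::
  "'a set \<Rightarrow> 'a set set \<Rightarrow> 'a oriented_simplex set \<Rightarrow> bool" where
  "complex_orientation V S K \<longleftrightarrow>
     K \<subseteq> oriented_simplices V S (complex_dim S) \<and>
     K \<inter> opposite ` K = {} \<and>
     oriented_simplices V S (complex_dim S) = K \<union> opposite ` K"

definition coherently_orientable :: "'a set \<Rightarrow> 'a set set \<Rightarrow> bool" where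
  "coherently_orientable V S \<longleftrightarrow>
     (\<exists>K. complex_orientation V S K \<and>
        (\<forall>\<sigma>\<^sub>1\<in>K. \<forall>\<sigma>\<^sub>2\<in>K. down_neighbors S (complex_dim S) (underlying \<sigma>\<^sub>1) (underlying \<sigma>\<^sub>2) \<longrightarrow>
           (\<forall>\<tau> \<in> oriented_simplices V S (complex_dim S - 1).
              underlying \<tau> = underlying \<sigma>\<^sub>1 \<inter> underlying \<sigma>\<^sub>2 \<longrightarrow>
              incidence_sgn \<sigma>\<^sub>1 \<tau> * incidence_sgn \<sigma>\<^sub>2 \<tau> = -1)))"

definition totally_noncoherently_orientable :: "'a set \<Rightarrow> 'a set set \<Rightarrow> bool" where
  "totally_noncoherently_orientable V S \<longleftrightarrow>
     (\<exists>K. complex_orientation V S K \<and>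
        (\<forall>\<sigma>\<^sub>1\<in>K. \<forall>\<sigma>\<^sub>2\<in>K. down_neighbors S (complex_dim S) (underlying \<sigma>\<^sub>1) (underlying \<sigma>\<^sub>2) \<longrightarrow>
           (\<forall>\<tau> \<in> oriented_simplices V S (complex_dim S - 1).
              underlying \<tau> = underlying \<sigma>\<^sub>1 \<inter> underlying \<sigma>\<^sub>2 \<longrightarrow>
              incidence_sgn \<sigma>\<^sub>1 \<tau> * incidence_sgn \<sigma>\<^sub>2 \<tau> = 1)))"

end

theory Submission
  imports Defs
begin

text \<open>
  Fix an arbitrary total order on the vertices. It gives every ordering of a simplex a sign, so that
  oriented simplices become pairs of a simplex and a sign, and the incidence numbers become explicit
  products of signs. In these coordinates the eigenvalue equation for \<open>c = \<plusminus>1\<close> forces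
  eigenfunctions to be odd under reversal of orientation, and after division by the square root of
  the degree it says that each value is \<open>c\<close> times the average of the neighboring values, twisted by
  signs. At a point of maximal modulus all averaged terms must coincide; by strong
  connectedness the function is constant up to sign, and these signs are the desired orientation.
\<close>

section \<open>Signs of vertex sequences\<close>

text \<open>A comparison of vertices recorded as a sign. The diagonal also takes values in
  \<open>{1, -1}\<close>, so every product of comparisons is again a sign.\<close>

locale sign_tournament =
  fixes sg :: "'a \<Rightarrow> 'a \<Rightarrow> int"
  assumes sg_cases: "sg a b \<in> {1, -1}"
    and sg_swap: "a \<noteq> b \<Longrightarrow> sg b a = - sg a b"

text \<open>The vertex type carries no order, so one is taken from the well-ordering
  theorem.\<close>

lemma sign_tournament_exists: "\<exists>sg :: 'a \<Rightarrow> 'a \<Rightarrow> int. sign_tournament sg"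
proof -
  obtain r :: "('a \<times> 'a) set" where "well_order_on UNIV r"
    using well_order_on by blast
  then have "total_on UNIV r" "antisym r"
    by (auto simp: well_order_on_def linear_order_on_def partial_order_on_def)
  then have "sign_tournament (\<lambda>a b. if (a, b) \<in> r then 1 else -1)"
    by unfold_locales (auto simp: total_on_def antisym_def)
  then show ?thesis by blast
qed

context sign_tournament
begin

text \<open>The product of \<open>sg\<close> over all pairs of entries, earlier one first. If
  \<open>sg\<close> comes from a linear order and the entries are distinct, this is
  \<open>-1\<close> to the number of inversions, that is, the sign of the sorting
  permutation.\<close>

primrec list_sgn :: "'a list \<Rightarrow> int" where
  "list_sgn [] = 1"
| "list_sgn (x # xs) = prod_list (map (sg x) xs) * list_sgn xs"

lemma prod_list_sg: "prod_list (map (sg a) xs) \<in> {1, -1}"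
proof (induction xs)
  case (Cons x xs)
  then show ?case using sg_cases[of a x] by auto
qed simp

lemma prod_sg: "(\<Prod>y\<in>G. sg a y) \<in> {1, -1}"
proof (induction G rule: infinite_finite_induct)
  case (insert x G)
  then show ?case using sg_cases[of a x] by auto
qed auto

lemma list_sgn_cases: "list_sgn s \<in> {1, -1}"
proof (induction s)
  case (Cons x xs)
  then show ?case using prod_list_sg[of x xs] by auto
qed simp

text \<open>Bringing \<open>a\<close> to the front reverses its comparison with each entry of
  \<open>xs\<close>, at the cost of one sign per entry; pairs without \<open>a\<close> are
  untouched.\<close>

lemma list_sgn_insert:
  "a \<notin> set xs \<Longrightarrow>
    list_sgn (xs @ a # ys) = (-1) ^ length xs * prod_list (map (sg a) (xs @ ys)) * list_sgn (xs @ ys)"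
proof (induction xs)
  case (Cons x xs)
  then have "sg x a = - sg a x" using sg_swap by auto
  with Cons show ?case by (simp add: algebra_simps)
qed simp

text \<open>Pulling both vertices out of either list leaves \<open>xs @ ys @ zs\<close> with the
  same factors, except that one list contributes \<open>sg a b\<close> and the other
  \<open>sg b a\<close>.\<close>

lemma list_sgn_exchange:
  assumes "distinct (xs @ a # ys @ b # zs)"
  shows "list_sgn (xs @ b # ys @ a # zs) = - list_sgn (xs @ a # ys @ b # zs)"
proof -
  have d: "a \<notin> set xs" "b \<notin> set xs" "a \<notin> set (xs @ ys)" "b \<notin> set (xs @ ys)" "sg b a = - sg a b"
    using assms sg_swap by auto
  show ?thesis
    using list_sgn_insert[OF d(1), of "ys @ b # zs"] list_sgn_insert[OF d(2), of "ys @ a # zs"]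
      list_sgn_insert[OF d(3), of zs] list_sgn_insert[OF d(4), of zs] d(5)
    by (simp add: algebra_simps)
qed

lemma list_sgn_transpose:
  assumes "distinct s" "i < j" "j < length s"
  shows "list_sgn (permute_list (Transposition.transpose i j) s) = - list_sgn s"
proof -
  define xs where "xs = take i s"
  define ys where "ys = take (j - Suc i) (drop (Suc i) s)"
  define zs where "zs = drop (Suc j) s"
  have s1: "s = xs @ s ! i # drop (Suc i) s"
    unfolding xs_def using assms by (intro id_take_nth_drop) auto
  \<comment> \<open>Position \<open>j\<close> of \<open>s\<close> is position
    \<open>j - Suc i\<close> of the tail behind position \<open>i\<close>.\<close>
  have "drop (Suc i) s = ys @ drop (Suc i) s ! (j - Suc i) # drop (Suc (j - Suc i)) (drop (Suc i) s)"
    unfolding ys_def using assms by (intro id_take_nth_drop) auto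
  then have s2: "drop (Suc i) s = ys @ s ! j # zs"
    using assms by (simp add: zs_def)
  have s: "s = xs @ s ! i # ys @ s ! j # zs" using s1 s2 by metis
  have len: "length xs = i" "length ys = j - Suc i" using assms by (auto simp: xs_def ys_def)
  have p: "permute_list (Transposition.transpose i j) s = xs @ s ! j # ys @ s ! i # zs"
  proof (rule nth_equalityI)
    show "length (permute_list (Transposition.transpose i j) s) = length (xs @ s ! j # ys @ s ! i # zs)"
      using arg_cong[OF s, of length] by simp
    fix k assume k: "k < length (permute_list (Transposition.transpose i j) s)"
    have perm: "Transposition.transpose i j permutes {..<length s}"
      using assms by (intro permutes_swap_id) auto
    have "permute_list (Transposition.transpose i j) s ! k = s ! Transposition.transpose i j k"
      using permute_list_nth[OF perm] k by simp
    moreover have "s ! Transposition.transpose i j k = (xs @ s ! j # ys @ s ! i # zs) ! k"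
    proof (cases "k = i \<or> k = j")
      case True
      then show ?thesis using len assms by (auto simp: nth_append nth_Cons')
    next
      case False
      then have "s ! Transposition.transpose i j k = (xs @ s ! i # ys @ s ! j # zs) ! k"
        using arg_cong[OF s, of "\<lambda>l. l ! k"] by simp
      also have "\<dots> = (xs @ s ! j # ys @ s ! i # zs) ! k"
        using False len assms by (auto simp: nth_append nth_Cons')
      finally show ?thesis .
    qed
    ultimately show "permute_list (Transposition.transpose i j) s ! k = (xs @ s ! j # ys @ s ! i # zs) ! k"
      by simp
  qed
  show ?thesis
    using list_sgn_exchange[of xs "s ! i" ys "s ! j" zs] assms(1) s p by metis
qed

text \<open>Induction over transpositions: each one reverses \<open>list_sgn\<close> just as it
  reverses the sign of the permutation.\<close>

lemma list_sgn_permute: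
  assumes "p permutes {..<length s}" "distinct s"
  shows "list_sgn (permute_list p s) = sign p * list_sgn s"
proof -
  \<comment> \<open>The list stays universally quantified because the induction hypothesis is
    applied to the transposed list.\<close>
  have "\<forall>s. length s = m \<longrightarrow> distinct s \<longrightarrow> list_sgn (permute_list p s) = sign p * list_sgn s"
    if "p permutes {..<m}" for m
    using that finite_lessThan
  proof (induction p rule: permutes_induct)
    case id
    then show ?case by simp
  next
    case (swap a b p)
    show ?case
    proof (intro allI impI)
      fix s :: "'a list" assume s: "length s = m" "distinct s"
      have t: "Transposition.transpose a b permutes {..<m}" using swap by (intro permutes_swap_id) auto
      have neg: "list_sgn (permute_list (Transposition.transpose a b) s) = - list_sgn s"
      proof (cases "a < b")
        case False
        then show ?thesis
          using list_sgn_transpose[of s b a] s swap by (simp add: transpose_commute)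
      qed (use list_sgn_transpose[of s a b] s swap in auto)
      have "list_sgn (permute_list (Transposition.transpose a b \<circ> p) s)
          = list_sgn (permute_list p (permute_list (Transposition.transpose a b) s))"
        using permute_list_compose[of p s "Transposition.transpose a b"] swap s by simp
      also have "\<dots> = sign p * list_sgn (permute_list (Transposition.transpose a b) s)"
        using swap s t by simp
      also have "\<dots> = sign (Transposition.transpose a b \<circ> p) * list_sgn s"
        using swap neg
        by (simp add: sign_compose sign_swap_id permutation_swap_id
            permutation_permutes[THEN iffD2, OF exI[of _ "{..<m}"]])
      finally show "list_sgn (permute_list (Transposition.transpose a b \<circ> p) s)
          = sign (Transposition.transpose a b \<circ> p) * list_sgn s" .
    qed
  qed
  then show ?thesis using assms by blast
qed

text \<open>The product runs over a set, so it depends only on the deleted vertex and the remaining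
  face; the position enters through \<open>(-1) ^ j\<close> alone, exactly as in the incidence
  number.\<close>

lemma list_sgn_delete:
  assumes "distinct s" "j < length s"
  shows "list_sgn s = (-1) ^ j * (\<Prod>y\<in>set s - {s ! j}. sg (s ! j) y)
           * list_sgn (take j s @ drop (Suc j) s)"
proof -
  have s: "s = take j s @ s ! j # drop (Suc j) s" using assms by (intro id_take_nth_drop) auto
  then have d: "distinct (take j s @ s ! j # drop (Suc j) s)" using assms by metis
  moreover have "set s = insert (s ! j) (set (take j s @ drop (Suc j) s))"
    using arg_cong[OF s, of set] by simp
  ultimately have "set s - {s ! j} = set (take j s @ drop (Suc j) s)"
    by auto
  moreover have "distinct (take j s @ drop (Suc j) s)" using d by auto
  ultimately have "(\<Prod>y\<in>set s - {s ! j}. sg (s ! j) y)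
      = prod_list (map (sg (s ! j)) (take j s @ drop (Suc j) s))"
    by (simp only: prod.distinct_set_conv_list)
  moreover have "s ! j \<notin> set (take j s)" using d by auto
  ultimately show ?thesis
    using list_sgn_insert[of "s ! j" "take j s" "drop (Suc j) s"] assms
    unfolding s[symmetric] by simp
qed

text \<open>Swapping the first two entries of any ordering reverses its sign, so both signs occur. A
  one-vertex list always has sign 1, hence the bound on the cardinality.\<close>

lemma ex_list_sgn:
  assumes "finite F" "card F \<ge> 2" "e \<in> {1, -1}"
  shows "\<exists>t. distinct t \<and> set t = F \<and> list_sgn t = e"
proof -
  obtain t where t: "set t = F" "distinct t" using finite_distinct_list assms(1) by blast
  then have len: "length t \<ge> 2" using assms(2) distinct_card by metis
  have p: "Transposition.transpose 0 1 permutes {..<length t}" using len by (intro permutes_swap_id) auto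
  have "distinct (permute_list (Transposition.transpose 0 1) t)" "set (permute_list (Transposition.transpose 0 1) t) = F"
    "list_sgn (permute_list (Transposition.transpose 0 1) t) = - list_sgn t"
    using t p len list_sgn_transpose[of t 0 1] by auto
  then show ?thesis using t list_sgn_cases[of t] assms(3) by force
qed

section \<open>Oriented simplices as signed simplices\<close>

text \<open>Coordinates on oriented simplices: an orientation of \<open>F\<close> is the set of its
  orderings with a given sign. Vertices are treated apart because their two orientations are not
  classes of lists.\<close>

definition signed_simplex :: "'a set \<Rightarrow> int \<Rightarrow> 'a oriented_simplex" where
  "signed_simplex F e =
     (if card F = 1 then Oriented_Vertex (the_elem F) e
      else Oriented_Class {t. distinct t \<and> set t = F \<and> list_sgn t = e})"

lemma permutation_between_lists:
  assumes "distinct s" "distinct t" "set s = set t"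
  obtains p where "p permutes {..<length s}" "permute_list p s = t" "list_sgn t = sign p * list_sgn s"
proof -
  have "mset t = mset s" using assms set_eq_iff_mset_eq_distinct by metis
  then obtain p where "p permutes {..<length s}" "permute_list p s = t"
    using mset_eq_permutation by blast
  then show ?thesis using that list_sgn_permute assms by metis
qed

text \<open>Two orderings of a simplex differ by a permutation whose sign is the ratio of theirs, so
  the orbit of \<open>s\<close> under even permutations is a level set of
  \<open>list_sgn\<close>.\<close>

lemma oriented_class_eq:
  assumes "distinct s" "s \<noteq> []"
  shows "oriented_class s = signed_simplex (set s) (list_sgn s)"
proof (cases "length s = 1")
  case True
  then obtain a where "s = [a]" by (auto simp: length_Suc_conv)
  then show ?thesis by (simp add: oriented_class_def signed_simplex_def)
next
  case False
  have "{permute_list p s |p. p permutes {..<length s} \<and> evenperm p}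
      = {t. distinct t \<and> set t = set s \<and> list_sgn t = list_sgn s}" (is "?L = ?R")
  proof
    show "?L \<subseteq> ?R" using assms list_sgn_permute by (auto simp: sign_def)
    show "?R \<subseteq> ?L"
    proof
      fix t assume "t \<in> ?R"
      then have t: "distinct t" "set s = set t" "list_sgn t = list_sgn s" by auto
      obtain p where p: "p permutes {..<length s}" "permute_list p s = t"
        "list_sgn t = sign p * list_sgn s"
        using permutation_between_lists[OF assms(1) t(1,2)] .
      then have "evenperm p" using t(3) list_sgn_cases[of s] by (auto simp: sign_def split: if_splits)
      then show "t \<in> ?L" using p by blast
    qed
  qed
  then show ?thesis
    using False assms by (simp add: oriented_class_def signed_simplex_def distinct_card)
qed

lemma underlying_signed_simplex:
  assumes "finite F" "F \<noteq> {}" "e \<in> {1, -1}"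
  shows "underlying (signed_simplex F e) = F"
proof (cases "card F = 1")
  case True
  then show ?thesis by (auto simp: signed_simplex_def card_1_singleton_iff)
next
  case False
  then have "card F \<ge> 2" using assms(1,2) by (cases "card F") auto
  then show ?thesis using ex_list_sgn[of F e] assms False by (auto simp: signed_simplex_def)
qed

text \<open>The simplex is recovered as the underlying set. The sign is recovered from the vertex
  constructor or from an ordering in the class, which is nonempty by
  \<open>ex_list_sgn\<close>.\<close>

lemma signed_simplex_inject:
  assumes "finite F" "F \<noteq> {}" "e \<in> {1, -1}" "finite F'" "F' \<noteq> {}" "e' \<in> {1, -1}"
  shows "signed_simplex F e = signed_simplex F' e' \<longleftrightarrow> F = F' \<and> e = e'"
proof
  assume eq: "signed_simplex F e = signed_simplex F' e'"
  then have F: "F' = F" using assms underlying_signed_simplex by metis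
  show "F = F' \<and> e = e'"
  proof (cases "card F = 1")
    case True
    then show ?thesis using eq F by (simp add: signed_simplex_def)
  next
    case False
    then have "card F \<ge> 2" using assms(1,2) by (cases "card F") auto
    then obtain t where "distinct t" "set t = F" "list_sgn t = e"
      using ex_list_sgn assms by blast
    then show ?thesis using eq F False by (auto simp: signed_simplex_def)
  qed
qed simp

text \<open>Odd permutations reverse \<open>list_sgn\<close>, and every ordering of sign
  \<open>- e\<close> is reached from one of sign \<open>e\<close>.\<close>

lemma opposite_signed_simplex:
  assumes "finite F" "F \<noteq> {}" "e \<in> {1, -1}"
  shows "opposite (signed_simplex F e) = signed_simplex F (- e)"
proof (cases "card F = 1")
  case True
  then show ?thesis by (simp add: signed_simplex_def)
next
  case False
  then have c: "card F \<ge> 2" using assms(1,2) by (cases "card F") auto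
  define C where "C = {t. distinct t \<and> set t = F \<and> list_sgn t = e}"
  have "{permute_list p s |p s. s \<in> C \<and> p permutes {..<length s} \<and> \<not> evenperm p}
      = {t. distinct t \<and> set t = F \<and> list_sgn t = - e}" (is "?L = ?R")
  proof
    show "?L \<subseteq> ?R" using list_sgn_permute by (auto simp: C_def sign_def)
    show "?R \<subseteq> ?L"
    proof
      fix t assume "t \<in> ?R"
      then have t: "distinct t" "set t = F" "list_sgn t = - e" by auto
      obtain s where s: "distinct s" "set s = F" "list_sgn s = e"
        using ex_list_sgn[OF assms(1) c assms(3)] by blast
      obtain p where p: "p permutes {..<length s}" "permute_list p s = t"
        "list_sgn t = sign p * list_sgn s"
        using permutation_between_lists[of s t] s t by metis
      then have "sign p * e = - e" using s(3) t(3) by simp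
      then have "\<not> evenperm p" using assms(3) by (auto simp: sign_def)
      moreover have "s \<in> C" using s by (simp add: C_def)
      ultimately show "t \<in> ?L" using p by blast
    qed
  qed
  then show ?thesis using False by (simp add: signed_simplex_def C_def)
qed

lemma oriented_class_signed_simplexD:
  assumes "oriented_class s = signed_simplex F e" "card F \<ge> 2"
  shows "distinct s \<and> set s = F \<and> list_sgn s = e"
proof -
  have "length s \<noteq> 1" using assms by (auto simp: oriented_class_def signed_simplex_def)
  \<comment> \<open>The identity places \<open>s\<close> in its own orbit, so its properties can be
    read off the class.\<close>
  moreover have "permute_list id s = s" "id permutes {..<length s}" "evenperm id"
    by (auto simp: permutes_id evenperm_id)
  then have "\<exists>p. s = permute_list p s \<and> p permutes {..<length s} \<and> evenperm p"
    by (intro exI[of _ id]) simp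
  ultimately show ?thesis
    using assms by (auto simp: oriented_class_def signed_simplex_def)
qed

text \<open>Deleting \<open>a\<close> at position \<open>j\<close> from an ordering of sign
  \<open>e\<close> leaves an ordering of \<open>G\<close> whose sign is \<open>(-1) ^ j * e\<close>
  times the product over \<open>G\<close>. Comparison with \<open>d\<close> determines
  \<open>(-1) ^ j\<close> up to known signs, so the description in \<open>incidence_sgn\<close> has
  exactly one solution, whatever the representative.\<close>

lemma incidence_sgn_signed_simplex:
  assumes "finite G" "G \<noteq> {}" "a \<notin> G" "e \<in> {1, -1}" "d \<in> {1, -1}"
  shows "incidence_sgn (signed_simplex (insert a G) e) (signed_simplex G d)
    = e * d * (\<Prod>y\<in>G. sg a y)"
proof -
  define \<sigma> where "\<sigma> = signed_simplex (insert a G) e"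
  define \<tau> where "\<tau> = signed_simplex G d"
  define P where "P = (\<Prod>y\<in>G. sg a y)"
  have c: "card (insert a G) \<ge> 2" using assms by (cases "card G") auto
  have opp: "opposite \<tau> = signed_simplex G (- d)"
    using assms opposite_signed_simplex by (auto simp: \<tau>_def)
  have P: "P \<in> {1, -1}" using prod_sg P_def by simp
  let ?Q = "\<lambda>x. \<exists>s j. \<sigma> = oriented_class s \<and> j < length s \<and>
             (\<tau> = oriented_class (take j s @ drop (Suc j) s) \<and> x = (-1) ^ j \<or>
              opposite \<tau> = oriented_class (take j s @ drop (Suc j) s) \<and> x = - ((-1) ^ j))"
  \<comment> \<open>Stated for every position, since in the uniqueness part the deleted vertex is
    not known beforehand.\<close>
  have face: "oriented_class (take j s @ drop (Suc j) s)
        = signed_simplex (insert a G - {s ! j}) ((-1) ^ j * e * (\<Prod>y\<in>insert a G - {s ! j}. sg (s ! j) y))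
      \<and> (-1) ^ j * e * (\<Prod>y\<in>insert a G - {s ! j}. sg (s ! j) y) \<in> {1, -1}"
    if s: "distinct s" "set s = insert a G" "list_sgn s = e" "j < length s" for s j
  proof -
    let ?r = "take j s @ drop (Suc j) s"
    have eq: "s = take j s @ s ! j # drop (Suc j) s" using s by (intro id_take_nth_drop) auto
    then have d: "distinct (take j s @ s ! j # drop (Suc j) s)" using s by metis
    have "set s = insert (s ! j) (set ?r)" using arg_cong[OF eq, of set] by simp
    then have r: "distinct ?r" "set ?r = insert a G - {s ! j}" using d s by auto
    have "length s \<ge> 2" using c s distinct_card[of s] by simp
    then have "?r \<noteq> []" by auto
    moreover have "list_sgn ?r = (-1) ^ j * e * (\<Prod>y\<in>insert a G - {s ! j}. sg (s ! j) y)"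
      using list_sgn_delete[OF s(1,4)] s prod_sg[of "s ! j" "insert a G - {s ! j}"] list_sgn_cases[of ?r]
      by (cases "even j") auto
    ultimately show ?thesis using oriented_class_eq[OF r(1)] r(2) list_sgn_cases[of ?r] by simp
  qed
  have "?Q (e * d * P)"
  proof -
    obtain s where s: "distinct s" "set s = insert a G" "list_sgn s = e"
      using ex_list_sgn[of "insert a G" e] c assms by auto
    then have "\<sigma> = oriented_class s"
      using oriented_class_eq[of s] by (cases s) (auto simp: \<sigma>_def)
    moreover obtain j where j: "j < length s" "s ! j = a"
      using s by (metis in_set_conv_nth insertI1)
    have "oriented_class (take j s @ drop (Suc j) s) = signed_simplex G ((-1) ^ j * e * P)"
      using face[OF s j(1)] j assms by (simp add: P_def)
    \<comment> \<open>The remaining ordering has sign \<open>d\<close> or \<open>- d\<close>; these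
      are the two alternatives of the definition.\<close>
    moreover have "(-1) ^ j * e * P = d \<and> e * d * P = (-1) ^ j
        \<or> (-1) ^ j * e * P = - d \<and> e * d * P = - ((-1) ^ j)"
      using assms P by (cases "even j") auto
    ultimately show ?thesis using j(1) opp unfolding \<tau>_def by metis
  qed
  moreover have "x = e * d * P" if Qx: "?Q x" for x
  proof -
    obtain s j where s: "\<sigma> = oriented_class s" "j < length s"
      and x: "\<tau> = oriented_class (take j s @ drop (Suc j) s) \<and> x = (-1) ^ j \<or>
              opposite \<tau> = oriented_class (take j s @ drop (Suc j) s) \<and> x = - ((-1) ^ j)"
      using Qx by blast
    have s': "distinct s" "set s = insert a G" "list_sgn s = e"
      using oriented_class_signed_simplexD[of s "insert a G" e] s c by (auto simp: \<sigma>_def)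
    define u where "u = (-1) ^ j * e * (\<Prod>y\<in>insert a G - {s ! j}. sg (s ! j) y)"
    have f: "oriented_class (take j s @ drop (Suc j) s) = signed_simplex (insert a G - {s ! j}) u"
      "u \<in> {1, -1}"
      using face[OF s' s(2)] by (auto simp: u_def)
    have fin: "finite (insert a G - {s ! j})" using assms by simp
    have ne: "insert a G - {s ! j} \<noteq> {}"
    proof
      assume "insert a G - {s ! j} = {}"
      then have "card (insert a G) \<le> card {s ! j}" by (intro card_mono) auto
      then show False using c by simp
    qed
    \<comment> \<open>Taking \<open>d' = d\<close> and \<open>d' = - d\<close> covers both
      alternatives.\<close>
    have inj: "signed_simplex G d' = signed_simplex (insert a G - {s ! j}) u
        \<longleftrightarrow> G = insert a G - {s ! j} \<and> d' = u" if "d' \<in> {1, -1}" for d'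
      using signed_simplex_inject[OF assms(1,2) that fin ne f(2)] .
    have "- d \<in> {1, -1}" using assms by auto
    then have x': "G = insert a G - {s ! j}" "d = u \<and> x = (-1) ^ j \<or> - d = u \<and> x = - ((-1) ^ j)"
      using x inj assms(5) unfolding opp f(1) by (auto simp: \<tau>_def)
    \<comment> \<open>Deleting any other vertex would keep \<open>a\<close> in the face.\<close>
    then have "s ! j = a" using assms(3) by auto
    then have "u = (-1) ^ j * e * P" using x'(1) by (simp add: u_def P_def)
    then show ?thesis using x'(2) assms P by (cases "even j") auto
  qed
  ultimately have "(THE x. ?Q x) = e * d * P" by (rule the_equality)
  moreover have "underlying \<tau> \<subseteq> underlying \<sigma>"
    using assms underlying_signed_simplex by (auto simp: \<sigma>_def \<tau>_def)
  ultimately show ?thesis by (simp add: incidence_sgn_def \<sigma>_def \<tau>_def P_def)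
qed

end

section \<open>The signed neighborhood graph\<close>

text \<open>The equality case of the triangle inequality. The deficits \<open>d i\<close> of the
  components along \<open>w\<close> are nonnegative and sum to zero, so each vanishes, which leaves
  no room for a distance between \<open>z i\<close> and \<open>w\<close>.\<close>

lemma sum_eq_card_imp_eq:
  fixes z :: "'b \<Rightarrow> complex"
  assumes "finite A" "\<And>i. i \<in> A \<Longrightarrow> cmod (z i) \<le> cmod w" "sum z A = of_nat (card A) * w" "i \<in> A"
  shows "z i = w"
proof -
  define d where "d i = (cmod w)\<^sup>2 - Re (z i * cnj w)" for i
  have nn: "d i \<ge> 0" if "i \<in> A" for i
  proof -
    have "Re (z i * cnj w) \<le> cmod (z i) * cmod w"
      using complex_Re_le_cmod[of "z i * cnj w"] by (simp add: norm_mult)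
    also have "\<dots> \<le> (cmod w)\<^sup>2"
      using assms(2)[OF that] by (simp add: power2_eq_square mult_right_mono)
    finally show ?thesis by (simp add: d_def)
  qed
  have "(\<Sum>i\<in>A. Re (z i * cnj w)) = Re (sum z A * cnj w)"
    by (simp only: sum_distrib_right Re_sum)
  also have "\<dots> = real (card A) * (cmod w)\<^sup>2"
    unfolding assms(3) by (simp add: cmod_def power2_eq_square algebra_simps)
  finally have "sum d A = 0" by (simp add: d_def sum_subtractf)
  then have "d i = 0" using nn assms(1,4) sum_nonneg_eq_0_iff by blast
  then have "Re (z i * cnj w) = (cmod w)\<^sup>2" by (simp add: d_def)
  moreover have "(cmod (z i - w))\<^sup>2 = (cmod (z i))\<^sup>2 + (cmod w)\<^sup>2 - 2 * Re (z i * cnj w)"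
    by (simp add: cmod_power2) (simp add: power2_eq_square algebra_simps)
  moreover have "(cmod (z i))\<^sup>2 \<le> (cmod w)\<^sup>2" using assms(2,4) by (simp add: power_mono)
  ultimately have "(cmod (z i - w))\<^sup>2 \<le> 0" by simp
  then show ?thesis by simp
qed

text \<open>Hypothesis \<open>conn\<close> is connectedness: no proper nonempty part is closed under
  neighbors. The resulting \<open>u\<close> compares \<open>\<phi>\<close> with its value at a point
  of maximal modulus.\<close>

lemma signed_graph_maximum_principle:
  fixes \<phi> :: "'b \<Rightarrow> complex" and h :: "'b \<Rightarrow> 'b \<Rightarrow> int"
  assumes fin: "finite X" and sub: "\<And>F. F \<in> X \<Longrightarrow> N F \<subseteq> X"
    and conn: "\<And>A. \<lbrakk>A \<subseteq> X; A \<noteq> {}; \<And>F G. F \<in> A \<Longrightarrow> G \<in> N F \<Longrightarrow> G \<in> A\<rbrakk> \<Longrightarrow> A = X"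
    and h: "\<And>F G. h F G \<in> {1, -1}" and c: "c \<in> {1, -1::int}"
    and eq: "\<And>F. F \<in> X \<Longrightarrow> of_int c * of_nat (card (N F)) * \<phi> F = (\<Sum>G\<in>N F. of_int (h F G) * \<phi> G)"
    and nz: "F0 \<in> X" "\<phi> F0 \<noteq> 0"
  shows "\<exists>u :: 'b \<Rightarrow> int. (\<forall>F. u F \<in> {1, -1}) \<and> (\<forall>F\<in>X. \<forall>G\<in>N F. u F * u G * h F G = c)"
proof -
  obtain M where M: "M \<in> X" "\<And>F. F \<in> X \<Longrightarrow> cmod (\<phi> F) \<le> cmod (\<phi> M)"
  proof -
    let ?I = "(\<lambda>F. cmod (\<phi> F)) ` X"
    have "finite ?I" "?I \<noteq> {}" using fin nz(1) by auto
    then obtain M where "M \<in> X" "cmod (\<phi> M) = Max ?I" using Max_in[of ?I] by (metis imageE)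
    moreover have "cmod (\<phi> F) \<le> Max ?I" if "F \<in> X" for F using fin that by (intro Max_ge) auto
    ultimately show ?thesis using that by metis
  qed
  define w where "w = \<phi> M"
  have w: "w \<noteq> 0" using M(2)[OF nz(1)] nz(2) by (auto simp: w_def)
  define A where "A = {F \<in> X. \<phi> F = w \<or> \<phi> F = - w}"
  \<comment> \<open>The twisted neighboring values average to \<open>c * \<phi> F\<close> and do not
    exceed it in modulus, so the equality case applies.\<close>
  have step: "of_int (h F G) * \<phi> G = of_int c * \<phi> F" if "F \<in> A" "G \<in> N F" for F G
  proof (rule sum_eq_card_imp_eq[where A = "N F" and z = "\<lambda>G. of_int (h F G) * \<phi> G"])
    have F: "F \<in> X" and nF: "cmod (\<phi> F) = cmod w" using that by (auto simp: A_def)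
    show "finite (N F)" using sub[OF F] fin finite_subset by blast
    show "cmod (of_int (h F G) * \<phi> G) \<le> cmod (of_int c * \<phi> F)" if "G \<in> N F" for G
    proof -
      have "cmod (\<phi> G) \<le> cmod w" using M(2) sub[OF F] that by (auto simp: w_def)
      then show ?thesis using h[of F G] c nF by (auto simp: norm_mult)
    qed
    show "(\<Sum>G\<in>N F. of_int (h F G) * \<phi> G) = of_nat (card (N F)) * (of_int c * \<phi> F)"
      using eq[OF F] by (simp add: mult_ac)
  qed (use that in auto)
  have "A = X"
  proof (rule conn)
    show "A \<subseteq> X" by (auto simp: A_def)
    show "A \<noteq> {}" using M(1) by (auto simp: A_def w_def)
    fix F G assume FG: "F \<in> A" "G \<in> N F"
    then have "G \<in> X" using sub by (auto simp: A_def)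
    then show "G \<in> A" using step[OF FG] h[of F G] c FG(1) by (auto simp: A_def minus_equation_iff)
  qed
  define u :: "'b \<Rightarrow> int" where "u F = (if \<phi> F = w then 1 else -1)" for F
  have \<phi>: "\<phi> F = of_int (u F) * w" if "F \<in> X" for F
    using that \<open>A = X\<close> by (auto simp: A_def u_def)
  have "u F * u G * h F G = c" if "F \<in> X" "G \<in> N F" for F G
  proof -
    have "G \<in> X" using sub that by blast
    then have "of_int (h F G) * (of_int (u G) * w) = of_int c * (of_int (u F) * w)"
      using step[of F G] that \<open>A = X\<close> \<phi> by metis
    then have "of_int (h F G * u G) = (of_int (c * u F) :: complex)" using w by simp
    then have "h F G * u G = c * u F" by (simp only: of_int_eq_iff)
    then show ?thesis by (auto simp: u_def)
  qed
  moreover have "u F \<in> {1, -1}" for F by (simp add: u_def)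
  ultimately show ?thesis by blast
qed

section \<open>Coordinates for the discriminant of a finite complex\<close>

locale finite_signed_complex = standing_complex V S + sign_tournament sg
  for V :: "'a set" and S :: "'a set set" and sg :: "'a \<Rightarrow> 'a \<Rightarrow> int" +
  assumes finite_vertices: "finite V"
    and two_simplices: "card (q_simplices S (complex_dim S)) \<ge> 2"
begin

abbreviation n :: nat where "n \<equiv> complex_dim S"
abbreviation X :: "'a set set" where "X \<equiv> q_simplices S n"

definition nbrs :: "'a set \<Rightarrow> 'a set set" where
  "nbrs F = {G \<in> X. down_neighbors S n G F}"

text \<open>The value of \<open>eta_down\<close> on the positively signed orientations of down neighbors \<open>F\<close>, \<open>G\<close>.\<close>

definition coupling :: "'a set \<Rightarrow> 'a set \<Rightarrow> int" where
  "coupling F G = (\<Prod>y\<in>F \<inter> G. sg (the_elem (F - G)) y) * (\<Prod>y\<in>F \<inter> G. sg (the_elem (G - F)) y)"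

lemma q_simplexD:
  assumes "F \<in> q_simplices S q"
  shows "F \<in> S" "finite F" "F \<noteq> {}" "card F = q + 1" "F \<subseteq> V"
  using assms simplex_subset[of F] by (auto simp: q_simplices_def)

lemma finite_q_simplices: "finite (q_simplices S q)"
proof (rule finite_subset)
  show "q_simplices S q \<subseteq> Pow V" using q_simplexD(5) by blast
qed (simp add: finite_vertices)

text \<open>Dimension zero is included because common faces have dimension \<open>n - 1\<close>,
  which may be zero. There the signs must be supplied directly, since \<open>oriented_class\<close>
  yields only positive vertices.\<close>

lemma oriented_simplices_eq:
  "oriented_simplices V S q = (\<lambda>(F, e). signed_simplex F e) ` (q_simplices S q \<times> {1, -1})"
proof (cases "q = 0")
  case True
  have 1: "{a} \<in> q_simplices S 0 \<and> signed_simplex {a} e = Oriented_Vertex a e" if "a \<in> V" for a e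
    using that singleton_simplex by (auto simp: q_simplices_def signed_simplex_def)
  have 2: "\<exists>a\<in>V. F = {a} \<and> (\<forall>e. signed_simplex F e = Oriented_Vertex a e)"
    if F: "F \<in> q_simplices S 0" for F
  proof -
    obtain a where "F = {a}" using q_simplexD(4)[OF F] by (auto simp: card_1_singleton_iff)
    then show ?thesis using q_simplexD(5)[OF F] by (auto simp: signed_simplex_def)
  qed
  show ?thesis
  proof
    show "oriented_simplices V S q \<subseteq> (\<lambda>(F, e). signed_simplex F e) ` (q_simplices S q \<times> {1, -1})"
    proof
      fix \<tau> assume "\<tau> \<in> oriented_simplices V S q"
      then obtain a e where "\<tau> = Oriented_Vertex a e" "a \<in> V" "e \<in> {1, -1}"
        using True by (auto simp: oriented_simplices_def)
      then show "\<tau> \<in> (\<lambda>(F, e). signed_simplex F e) ` (q_simplices S q \<times> {1, -1})"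
        using 1[of a e] True by (intro image_eqI[of _ _ "({a}, e)"]) auto
    qed
    show "(\<lambda>(F, e). signed_simplex F e) ` (q_simplices S q \<times> {1, -1}) \<subseteq> oriented_simplices V S q"
      using 2 True by (fastforce simp: oriented_simplices_def)
  qed
next
  case False
  show ?thesis
  proof
    show "oriented_simplices V S q \<subseteq> (\<lambda>(F, e). signed_simplex F e) ` (q_simplices S q \<times> {1, -1})"
    proof
      fix \<tau> assume "\<tau> \<in> oriented_simplices V S q"
      then obtain s where s: "\<tau> = oriented_class s" "length s = q + 1" "set s \<in> q_simplices S q"
        using False by (auto simp: oriented_simplices_def vertex_sequences_def)
      then have "distinct s" "s \<noteq> []" using q_simplexD(4)[OF s(3)] by (auto simp: card_distinct)
      then show "\<tau> \<in> (\<lambda>(F, e). signed_simplex F e) ` (q_simplices S q \<times> {1, -1})"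
        using s oriented_class_eq list_sgn_cases[of s]
        by (intro image_eqI[of _ _ "(set s, list_sgn s)"]) auto
    qed
    show "(\<lambda>(F, e). signed_simplex F e) ` (q_simplices S q \<times> {1, -1}) \<subseteq> oriented_simplices V S q"
    proof clarify
      fix F and e :: int assume F: "F \<in> q_simplices S q" and e: "e \<in> {1, -1}"
      have "card F \<ge> 2" using q_simplexD(4)[OF F] False by simp
      then obtain s where s: "distinct s" "set s = F" "list_sgn s = e"
        using ex_list_sgn q_simplexD(2)[OF F] e by blast
      moreover have "s \<noteq> []" using s q_simplexD(3)[OF F] by auto
      ultimately have "signed_simplex F e = oriented_class s" using oriented_class_eq by simp
      moreover have "s \<in> vertex_sequences S q"
        using s F q_simplexD(4)[OF F] distinct_card[of s] by (simp add: vertex_sequences_def)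
      ultimately show "signed_simplex F e \<in> oriented_simplices V S q"
        using False by (simp add: oriented_simplices_def)
    qed
  qed
qed

lemma signed_simplex_in:
  "F \<in> q_simplices S q \<Longrightarrow> e \<in> {1, -1} \<Longrightarrow> signed_simplex F e \<in> oriented_simplices V S q"
  unfolding oriented_simplices_eq by (intro image_eqI[of _ _ "(F, e)"]) auto

lemma oriented_simplexE:
  assumes "\<tau> \<in> oriented_simplices V S q"
  obtains F e where "\<tau> = signed_simplex F e" "F \<in> q_simplices S q" "e \<in> {1, -1}"
  using assms unfolding oriented_simplices_eq by auto

lemma underlying_eq: "F \<in> q_simplices S q \<Longrightarrow> e \<in> {1, -1} \<Longrightarrow> underlying (signed_simplex F e) = F"
  by (intro underlying_signed_simplex q_simplexD(2,3))

lemma opposite_eq: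
  "F \<in> q_simplices S q \<Longrightarrow> e \<in> {1, -1} \<Longrightarrow> opposite (signed_simplex F e) = signed_simplex F (- e)"
  by (intro opposite_signed_simplex q_simplexD(2,3))

lemma signed_simplex_eq_iff:
  "F \<in> q_simplices S q \<Longrightarrow> e \<in> {1, -1} \<Longrightarrow> G \<in> q_simplices S q \<Longrightarrow> d \<in> {1, -1} \<Longrightarrow>
    signed_simplex F e = signed_simplex G d \<longleftrightarrow> F = G \<and> e = d"
  by (intro signed_simplex_inject q_simplexD(2,3))

lemma nbrs_iff: "G \<in> nbrs F \<longleftrightarrow> down_neighbors S n F G"
proof -
  have "G \<inter> F = F \<inter> G" by blast
  then show ?thesis unfolding nbrs_def down_neighbors_def by auto
qed

lemma nbrs_subset: "nbrs F \<subseteq> X"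
  by (auto simp: nbrs_def)

lemma coupling_cases: "coupling F G \<in> {1, -1}"
proof -
  have "x * y \<in> {1, -1}" if "x \<in> {1, -1}" "y \<in> {1, -1}" for x y :: int
    using that by auto
  then show ?thesis unfolding coupling_def using prod_sg by blast
qed

text \<open>The sign of \<open>\<mu>\<close> occurs in both factors and cancels. What remains is the
  comparison of the two vertices off the common face with that face.\<close>

lemma incidence_product:
  assumes "down_neighbors S n F G" "e \<in> {1, -1}" "d \<in> {1, -1}"
    and "\<mu> \<in> oriented_simplices V S (n - 1)" "underlying \<mu> = F \<inter> G"
  shows "incidence_sgn (signed_simplex F e) \<mu> * incidence_sgn (signed_simplex G d) \<mu>
    = e * d * coupling F G"
proof -
  have FG: "F \<in> X" "G \<in> X" "F \<inter> G \<in> q_simplices S (n - 1)"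
    using assms(1) by (auto simp: down_neighbors_def)
  have fin: "finite F" "finite G" using FG q_simplexD by auto
  \<comment> \<open>Since the dimension is at least 1, the truncated \<open>n - 1\<close> is a true
    predecessor and the face has \<open>n\<close> vertices.\<close>
  have ci: "card (F \<inter> G) = n" using q_simplexD(4)[OF FG(3)] dim_ge_1 by simp
  have "card (F - G) = 1" "card (G - F) = 1"
    using q_simplexD(4)[OF FG(1)] q_simplexD(4)[OF FG(2)] fin ci
    by (simp_all add: card_Diff_subset_Int Int_commute)
  then obtain a b where ab: "F - G = {a}" "G - F = {b}" by (auto simp: card_1_singleton_iff)
  then have F: "F = insert a (F \<inter> G)" "a \<notin> F \<inter> G" and G: "G = insert b (F \<inter> G)" "b \<notin> F \<inter> G"
    by auto
  obtain H x where "\<mu> = signed_simplex H x" "H \<in> q_simplices S (n - 1)" "x \<in> {1, -1}"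
    using oriented_simplexE[OF assms(4)] .
  then have \<mu>: "\<mu> = signed_simplex (F \<inter> G) x" and x: "x \<in> {1, -1}"
    using assms(5) underlying_eq by auto
  have "incidence_sgn (signed_simplex F e) \<mu> = e * x * (\<Prod>y\<in>F \<inter> G. sg a y)"
    using incidence_sgn_signed_simplex[of "F \<inter> G" a e x] q_simplexD[OF FG(3)] F assms(2) x
    unfolding \<mu> by metis
  moreover have "incidence_sgn (signed_simplex G d) \<mu> = d * x * (\<Prod>y\<in>F \<inter> G. sg b y)"
    using incidence_sgn_signed_simplex[of "F \<inter> G" b d x] q_simplexD[OF FG(3)] G assms(3) x
    unfolding \<mu> by metis
  moreover have "x * x = 1" using x by auto
  then have "(e * x * p) * (d * x * q) = e * d * (p * q)" for p q
    by (metis mult.assoc mult.commute mult.left_neutral)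
  ultimately show ?thesis unfolding coupling_def ab the_elem_eq by simp
qed

text \<open>Justifies the choice made in \<open>eta_down\<close>, and ensures that the orientability
  conditions say something about every pair of down neighbors.\<close>

lemma common_face_exists:
  assumes "down_neighbors S n F G"
  shows "\<exists>\<mu>. \<mu> \<in> oriented_simplices V S (n - 1) \<and> underlying \<mu> = F \<inter> G"
proof -
  have "F \<inter> G \<in> q_simplices S (n - 1)" using assms by (simp add: down_neighbors_def)
  then have "signed_simplex (F \<inter> G) 1 \<in> oriented_simplices V S (n - 1)"
    "underlying (signed_simplex (F \<inter> G) 1) = F \<inter> G"
    using signed_simplex_in[of "F \<inter> G" "n - 1" 1] underlying_eq[of "F \<inter> G" "n - 1" 1] by simp_all
  then show ?thesis by blast
qed

lemma eta_down_eq: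
  assumes "down_neighbors S n F G" "e \<in> {1, -1}" "d \<in> {1, -1}"
  shows "eta_down V S n (signed_simplex F e) (signed_simplex G d) = e * d * coupling F G"
proof -
  have FG: "F \<in> X" "G \<in> X" using assms(1) by (auto simp: down_neighbors_def)
  define \<mu> where "\<mu> = (SOME \<mu>. \<mu> \<in> oriented_simplices V S (n - 1) \<and> underlying \<mu> = F \<inter> G)"
  have "\<mu> \<in> oriented_simplices V S (n - 1)" "underlying \<mu> = F \<inter> G"
    using someI_ex[OF common_face_exists[OF assms(1)]] unfolding \<mu>_def by auto
  then show ?thesis
    unfolding eta_down_def Let_def underlying_eq[OF FG(1) assms(2)] underlying_eq[OF FG(2) assms(3)]
      \<mu>_def[symmetric]
    by (rule incidence_product[OF assms])
qed

lemma down_degree_eq: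
  "F \<in> X \<Longrightarrow> e \<in> {1, -1} \<Longrightarrow> down_degree S n (signed_simplex F e) = card (nbrs F)"
  using underlying_eq[of F n e] by (simp add: down_degree_def nbrs_def)

text \<open>A closed set absorbs every chain of strong connectedness that starts in it.\<close>

lemma nbrs_closed_imp_all:
  assumes A: "A \<subseteq> X" "A \<noteq> {}" and closed: "\<And>F G. F \<in> A \<Longrightarrow> G \<in> nbrs F \<Longrightarrow> G \<in> A"
  shows "A = X"
proof
  have chain: "set ts \<subseteq> A"
    if "hd ts \<in> A" "ts \<noteq> []" "set ts \<subseteq> X" "successively (\<lambda>A B. A \<inter> B \<in> q_simplices S (n - 1)) ts" for ts
    using that
  proof (induction ts)
    case step: (Cons F ts)
    show ?case
    proof (cases ts)
      case Nil
      then show ?thesis using step.prems by simp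
    next
      case ts: (Cons G ts')
      have "F \<in> A" "G \<in> X" "F \<in> X" "F \<inter> G \<in> q_simplices S (n - 1)"
        using step.prems by (auto simp: ts)
      \<comment> \<open>Down neighbors are distinct by definition, so a repeated entry is split off;
        closure is trivial for it.\<close>
      then have "G = F \<or> G \<in> nbrs F" by (auto simp: nbrs_iff down_neighbors_def)
      then have "G \<in> A" using closed[OF \<open>F \<in> A\<close>] \<open>F \<in> A\<close> by blast
      then have "set ts \<subseteq> A" using step.prems by (intro step.IH) (auto simp: ts)
      then show ?thesis using \<open>F \<in> A\<close> by simp
    qed
  qed simp
  show "X \<subseteq> A"
  proof
    fix G assume G: "G \<in> X"
    obtain F where F: "F \<in> A" using A by blast
    then obtain ts where "ts \<noteq> []" "hd ts = F" "last ts = G" "set ts \<subseteq> X"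
      "successively (\<lambda>A B. A \<inter> B \<in> q_simplices S (n - 1)) ts"
      using strongly_connected[of F G] A G by blast
    then show "G \<in> A" using chain[of ts] F last_in_set[of ts] by auto
  qed
qed (rule A)

text \<open>A simplex without neighbors would by itself be a closed set, hence the only
  top-dimensional simplex.\<close>

lemma card_nbrs_pos:
  assumes "F \<in> X"
  shows "card (nbrs F) > 0"
proof (rule ccontr)
  assume "\<not> card (nbrs F) > 0"
  moreover have "finite (nbrs F)" using nbrs_subset finite_q_simplices finite_subset by blast
  ultimately have "nbrs F = {}" by simp
  then have "{F} = X" using assms by (intro nbrs_closed_imp_all) auto
  then show False using two_simplices by (metis card_1_singleton_iff One_nat_def Suc_1 not_less_eq_eq order_refl)
qed

text \<open>The two orientations of each neighbor enter with opposite \<open>eta_down\<close>, which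
  gives the difference. The sign \<open>e\<close> survives only as an outer factor, so the image of
  every \<open>g\<close> is odd.\<close>

lemma down_discriminant_eq:
  assumes F: "F \<in> X" and e: "e \<in> {1, -1}"
  shows "down_discriminant V S n g (signed_simplex F e) =
    of_int e * (\<Sum>G\<in>nbrs F. of_int (coupling F G) /
        of_real (2 * (sqrt (card (nbrs F)) * sqrt (card (nbrs G)))) *
        (g (signed_simplex G 1) - g (signed_simplex G (-1))))"
proof -
  let ?s = "\<lambda>(G, d). signed_simplex G d"
  let ?t = "\<lambda>\<tau>'. of_int (eta_down V S n (signed_simplex F e) \<tau>') /
      of_real (sqrt (2 * real (down_degree S n (signed_simplex F e))) * sqrt (2 * real (down_degree S n \<tau>'))) *
      g \<tau>'"
  have idx: "{\<tau>' \<in> oriented_simplices V S n. down_neighbors S n (underlying \<tau>') F}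
      = ?s ` (nbrs F \<times> {1, -1})"
  proof
    show "{\<tau>' \<in> oriented_simplices V S n. down_neighbors S n (underlying \<tau>') F} \<subseteq> ?s ` (nbrs F \<times> {1, -1})"
    proof clarify
      fix \<tau> assume \<tau>: "\<tau> \<in> oriented_simplices V S n" "down_neighbors S n (underlying \<tau>) F"
      obtain G d where G: "\<tau> = signed_simplex G d" "G \<in> X" "d \<in> {1, -1}"
        using oriented_simplexE[OF \<tau>(1)] .
      then have "G \<in> nbrs F" using \<tau>(2) underlying_eq[of G n d] by (simp add: nbrs_def)
      then show "\<tau> \<in> ?s ` (nbrs F \<times> {1, -1})" using G by (intro image_eqI[of _ _ "(G, d)"]) auto
    qed
    show "?s ` (nbrs F \<times> {1, -1}) \<subseteq> {\<tau>' \<in> oriented_simplices V S n. down_neighbors S n (underlying \<tau>') F}"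
    proof clarify
      fix G and d :: int assume "G \<in> nbrs F" "d \<in> {1, -1}"
      then show "signed_simplex G d \<in> oriented_simplices V S n
          \<and> down_neighbors S n (underlying (signed_simplex G d)) F"
        using signed_simplex_in[of G n d] underlying_eq[of G n d] by (simp add: nbrs_def)
    qed
  qed
  have inj: "inj_on ?s (nbrs F \<times> {1, -1})"
  proof (rule inj_onI, clarify)
    fix G G' and d d' :: int
    assume "G \<in> nbrs F" "d \<in> {1, -1}" "G' \<in> nbrs F" "d' \<in> {1, -1}"
      "signed_simplex G d = signed_simplex G' d'"
    then show "G = G' \<and> d = d'" using signed_simplex_eq_iff[of G n d G' d'] by (simp add: nbrs_def)
  qed
  have summand: "?t (signed_simplex G d) = of_int e * (of_int (coupling F G) /
        of_real (2 * (sqrt (card (nbrs F)) * sqrt (card (nbrs G)))) * (of_int d * g (signed_simplex G d)))"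
    if "G \<in> nbrs F" "d \<in> {1, -1}" for G d
  proof -
    have "G \<in> X" "down_neighbors S n F G" using that(1) nbrs_iff by (auto simp: nbrs_def)
    \<comment> \<open>The factors 2 under the two roots merge into the single 2 of the
      denominator.\<close>
    moreover have "sqrt (2 * x) * sqrt (2 * y) = 2 * (sqrt x * sqrt y)" for x y
      by (simp add: real_sqrt_mult)
    ultimately show ?thesis
      unfolding eta_down_eq[OF \<open>down_neighbors S n F G\<close> e that(2)]
        down_degree_eq[OF F e] down_degree_eq[OF \<open>G \<in> X\<close> that(2)] by simp
  qed
  have "down_discriminant V S n g (signed_simplex F e) = sum ?t (?s ` (nbrs F \<times> {1, -1}))"
    using signed_simplex_in[OF F e] underlying_eq[OF F e] idx by (simp add: down_discriminant_def)
  also have "\<dots> = (\<Sum>(G, d)\<in>nbrs F \<times> {1, -1}. ?t (signed_simplex G d))"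
    using inj by (simp add: sum.reindex case_prod_unfold)
  also have "\<dots> = (\<Sum>G\<in>nbrs F. \<Sum>d\<in>{1, -1}. ?t (signed_simplex G d))"
    by (simp only: sum.cartesian_product)
  also have "\<dots> = (\<Sum>G\<in>nbrs F. of_int e * (of_int (coupling F G) /
        of_real (2 * (sqrt (card (nbrs F)) * sqrt (card (nbrs G)))) *
        (g (signed_simplex G 1) - g (signed_simplex G (-1)))))"
  proof (rule sum.cong[OF refl])
    fix G assume G: "G \<in> nbrs F"
    have "(\<Sum>d\<in>{1, -1}. ?t (signed_simplex G d))
        = ?t (signed_simplex G 1) + ?t (signed_simplex G (-1))"
      by (rule sum.insert[THEN trans]) simp_all
    moreover have "(1::int) \<in> {1, -1}" "(-1::int) \<in> {1, -1}" by simp_all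
    note summand[OF G this(1)] summand[OF G this(2)]
    ultimately show "(\<Sum>d\<in>{1, -1}. ?t (signed_simplex G d)) = of_int e * (of_int (coupling F G) /
        of_real (2 * (sqrt (card (nbrs F)) * sqrt (card (nbrs G)))) *
        (g (signed_simplex G 1) - g (signed_simplex G (-1))))"
      by (simp only: of_int_1 of_int_minus mult_1 mult_minus_left mult_minus_right
          distrib_left diff_conv_add_uminus)
  qed
  finally show ?thesis by (simp add: sum_distrib_left)
qed

section \<open>Eigenvalues and orientations\<close>

text \<open>An eigenfunction descends to a function on simplices that satisfies the averaging
  equation of the maximum principle.\<close>

lemma eigenvalue_imp_signs:
  assumes c: "c \<in> {1, -1::int}"
    and "has_eigenvalue (l2_space (oriented_simplices V S n)) (down_discriminant V S n) (of_int c)"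
  shows "\<exists>u :: 'a set \<Rightarrow> int. (\<forall>F. u F \<in> {1, -1}) \<and> (\<forall>F\<in>X. \<forall>G\<in>nbrs F. u F * u G * coupling F G = c)"
proof -
  obtain g where g: "g \<in> l2_space (oriented_simplices V S n)" "g \<noteq> (\<lambda>x. 0)"
    and eig: "down_discriminant V S n g = (\<lambda>x. of_int c * g x)"
    using assms(2) by (auto simp: has_eigenvalue_def)
  define R where "R F = (\<Sum>G\<in>nbrs F. of_int (coupling F G) /
        of_real (2 * (sqrt (card (nbrs F)) * sqrt (card (nbrs G)))) *
        (g (signed_simplex G 1) - g (signed_simplex G (-1))))" for F
  have eq: "of_int c * g (signed_simplex F e) = of_int e * R F" if "F \<in> X" "e \<in> {1, -1}" for F e
    using down_discriminant_eq[OF that, of g] fun_cong[OF eig] by (simp add: R_def)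
  \<comment> \<open>\<open>R F\<close> does not depend on the orientation and \<open>c\<close> is
    nonzero, so oddness passes from the image to \<open>g\<close>.\<close>
  have odd: "g (signed_simplex F (-1)) = - g (signed_simplex F 1)" if "F \<in> X" for F
    using eq[OF that, of 1] eq[OF that, of "-1"] c by (auto simp: minus_equation_iff)
  \<comment> \<open>Dividing by the root of the degree turns the symmetric normalization into a
    plain average over neighbors.\<close>
  define \<phi> where "\<phi> F = g (signed_simplex F 1) / of_real (sqrt (card (nbrs F)))" for F
  have pos: "complex_of_real (sqrt (card (nbrs F))) \<noteq> 0" if "F \<in> X" for F
    using card_nbrs_pos[OF that] by simp
  obtain \<tau> where \<tau>: "g \<tau> \<noteq> 0" using g(2) by blast
  then have "\<tau> \<in> oriented_simplices V S n" using g(1) by (auto simp: l2_space_def)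
  then obtain F0 e0 where F0: "\<tau> = signed_simplex F0 e0" "F0 \<in> X" "e0 \<in> {1, -1}"
    using oriented_simplexE by blast
  then have "g (signed_simplex F0 1) \<noteq> 0" using \<tau> odd by auto
  then have nz: "\<phi> F0 \<noteq> 0" using pos[OF F0(2)] by (simp add: \<phi>_def)
  have "of_int c * of_nat (card (nbrs F)) * \<phi> F = (\<Sum>G\<in>nbrs F. of_int (coupling F G) * \<phi> G)"
    if F: "F \<in> X" for F
  proof -
    let ?q = "\<lambda>F. complex_of_real (sqrt (card (nbrs F)))"
    have sq: "of_nat (card (nbrs F)) = ?q F * ?q F"
      by (simp flip: of_real_mult)
    have "of_int c * of_nat (card (nbrs F)) * \<phi> F = ?q F * (of_int c * g (signed_simplex F 1))"
      unfolding sq \<phi>_def using pos[OF F] by simp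
    also have "\<dots> = ?q F * R F" using eq[OF F, of 1] by simp
    also have "\<dots> = (\<Sum>G\<in>nbrs F. of_int (coupling F G) * \<phi> G)"
      unfolding R_def sum_distrib_left
    proof (rule sum.cong[OF refl])
      fix G assume "G \<in> nbrs F"
      then have G: "G \<in> X" using nbrs_subset by blast
      \<comment> \<open>By oddness the difference is twice the value at the positive orientation,
        which cancels the 2.\<close>
      show "?q F * (of_int (coupling F G) / of_real (2 * (sqrt (card (nbrs F)) * sqrt (card (nbrs G)))) *
          (g (signed_simplex G 1) - g (signed_simplex G (-1)))) = of_int (coupling F G) * \<phi> G"
        unfolding odd[OF G] \<phi>_def of_real_mult using pos[OF F] pos[OF G] by (simp add: field_simps)
    qed
    finally show ?thesis .
  qed
  then show ?thesis
    by (intro signed_graph_maximum_principle[where \<phi> = \<phi> and ?F0.0 = F0])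
      (use finite_q_simplices nbrs_subset nbrs_closed_imp_all coupling_cases c F0 nz in auto)
qed

text \<open>The previous computation is run backwards: the eigenfunction is \<open>u\<close> times
  the root of the degree, extended oddly to both orientations.\<close>

lemma signs_imp_eigenvalue:
  fixes u :: "'a set \<Rightarrow> int"
  assumes u: "\<And>F. u F \<in> {1, -1}" and uc: "\<And>F G. F \<in> X \<Longrightarrow> G \<in> nbrs F \<Longrightarrow> u F * u G * coupling F G = c"
  shows "has_eigenvalue (l2_space (oriented_simplices V S n)) (down_discriminant V S n) (of_int c)"
proof -
  let ?K = "oriented_simplices V S n"
  let ?q = "\<lambda>F. complex_of_real (sqrt (card (nbrs F)))"
  \<comment> \<open>The test against the positive orientation reads off the sign of an oriented
    simplex.\<close>
  define g :: "'a oriented_simplex \<Rightarrow> complex" where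
    "g \<tau> = (if \<tau> \<in> ?K then of_int ((if \<tau> = signed_simplex (underlying \<tau>) 1 then 1 else -1)
        * u (underlying \<tau>)) * ?q (underlying \<tau>) else 0)" for \<tau>
  have g: "g (signed_simplex F e) = of_int (e * u F) * ?q F" if "F \<in> X" "e \<in> {1, -1}" for F e
    using that signed_simplex_in[OF that] underlying_eq[OF that] signed_simplex_eq_iff[OF that that(1), of 1]
    by (auto simp: g_def)
  have pos: "?q F \<noteq> 0" if "F \<in> X" for F
    using card_nbrs_pos[OF that] by simp
  \<comment> \<open>On a finite set square summability is automatic.\<close>
  have "finite ?K" unfolding oriented_simplices_eq using finite_q_simplices by auto
  then have "g \<in> l2_space ?K" by (auto simp: l2_space_def g_def)
  moreover have "g \<noteq> (\<lambda>x. 0)"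
  proof -
    obtain F where "F \<in> X" using two_simplices by fastforce
    then have "g (signed_simplex F 1) \<noteq> 0" using g[of F 1] u[of F] pos[of F] by auto
    then show ?thesis by auto
  qed
  moreover have "down_discriminant V S n g = (\<lambda>\<tau>. of_int c * g \<tau>)"
  proof
    fix \<tau>
    show "down_discriminant V S n g \<tau> = of_int c * g \<tau>"
    proof (cases "\<tau> \<in> ?K")
      case True
      then obtain F e where \<tau>: "\<tau> = signed_simplex F e" and F: "F \<in> X" and e: "e \<in> {1, -1}"
        using oriented_simplexE by blast
      have "(\<Sum>G\<in>nbrs F. of_int (coupling F G) / of_real (2 * (sqrt (card (nbrs F)) * sqrt (card (nbrs G)))) *
          (g (signed_simplex G 1) - g (signed_simplex G (-1)))) = (\<Sum>G\<in>nbrs F. of_int (c * u F) / ?q F)"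
      proof (rule sum.cong[OF refl])
        fix G assume GF: "G \<in> nbrs F"
        then have G: "G \<in> X" using nbrs_subset by blast
        \<comment> \<open>The relation \<open>uc\<close> is multiplied by \<open>u F\<close>, whose
          square is 1.\<close>
        have "coupling F G * u G = c * u F" using uc[OF F GF] u[of F] by auto
        then have "complex_of_int (coupling F G) * of_int (u G) = of_int (c * u F)"
          by (metis of_int_mult)
        then show "of_int (coupling F G) / of_real (2 * (sqrt (card (nbrs F)) * sqrt (card (nbrs G)))) *
          (g (signed_simplex G 1) - g (signed_simplex G (-1))) = of_int (c * u F) / ?q F"
          using g[OF G, of 1] g[OF G, of "-1"] pos[OF F] pos[OF G] by (simp add: field_simps)
      qed
      \<comment> \<open>The summand no longer depends on \<open>G\<close>, and the degree divided by
        its root is the root.\<close>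
      also have "\<dots> = of_int (c * u F) * ?q F"
      proof -
        have "of_nat (card (nbrs F)) = ?q F * ?q F" by (simp flip: of_real_mult)
        then show ?thesis using pos[OF F] by simp
      qed
      finally show ?thesis
        unfolding \<tau> down_discriminant_eq[OF F e] g[OF F e] by simp
    next
      case False
      then show ?thesis by (simp add: down_discriminant_def g_def)
    qed
  qed
  ultimately show ?thesis unfolding has_eigenvalue_def by blast
qed

section \<open>Sign functions and orientations\<close>

text \<open>One parameter treats both notions together: \<open>c = 1\<close> is total non-coherence
  and \<open>c = -1\<close> is coherence.\<close>

definition oriented_with_product :: "int \<Rightarrow> bool" where
  "oriented_with_product c \<longleftrightarrow>
     (\<exists>K. complex_orientation V S K \<and>
        (\<forall>\<sigma>\<^sub>1\<in>K. \<forall>\<sigma>\<^sub>2\<in>K. down_neighbors S n (underlying \<sigma>\<^sub>1) (underlying \<sigma>\<^sub>2) \<longrightarrow>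
           (\<forall>\<tau> \<in> oriented_simplices V S (n - 1).
              underlying \<tau> = underlying \<sigma>\<^sub>1 \<inter> underlying \<sigma>\<^sub>2 \<longrightarrow>
              incidence_sgn \<sigma>\<^sub>1 \<tau> * incidence_sgn \<sigma>\<^sub>2 \<tau> = c)))"

text \<open>\<open>u\<close> selects one orientation of each simplex; the opposite ones carry the
  sign \<open>- u F\<close>, so the two families partition all orientations.\<close>

lemma signs_imp_orientation:
  fixes u :: "'a set \<Rightarrow> int"
  assumes u: "\<And>F. u F \<in> {1, -1}" and uc: "\<And>F G. F \<in> X \<Longrightarrow> G \<in> nbrs F \<Longrightarrow> u F * u G * coupling F G = c"
  shows "oriented_with_product c"
proof -
  define K where "K = (\<lambda>F. signed_simplex F (u F)) ` X"
  have u': "- u F \<in> {1, -1}" for F using u[of F] by auto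
  have opp: "opposite ` K = (\<lambda>F. signed_simplex F (- u F)) ` X"
    unfolding K_def image_image using opposite_eq[OF _ u] by (intro image_cong) simp_all
  have "complex_orientation V S K"
    unfolding complex_orientation_def
  proof (intro conjI)
    show sub: "K \<subseteq> oriented_simplices V S n" using signed_simplex_in[OF _ u] by (auto simp: K_def)
    show "K \<inter> opposite ` K = {}"
    proof -
      have "signed_simplex F (u F) \<noteq> signed_simplex G (- u G)" if "F \<in> X" "G \<in> X" for F G
        using signed_simplex_eq_iff[OF that(1) u that(2) u'] u[of F] by auto
      then show ?thesis unfolding opp by (auto simp: K_def)
    qed
    have "opposite ` K \<subseteq> oriented_simplices V S n"
      unfolding opp using signed_simplex_in[OF _ u'] by auto
    moreover have "signed_simplex F e \<in> K \<union> opposite ` K" if "F \<in> X" "e \<in> {1, -1}" for F e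
    proof -
      have "e = u F \<or> e = - u F" using that(2) u[of F] by auto
      then show ?thesis unfolding opp unfolding K_def using that(1) by blast
    qed
    ultimately show "oriented_simplices V S n = K \<union> opposite ` K"
      using sub by (auto elim!: oriented_simplexE)
  qed
  moreover have "incidence_sgn \<sigma>1 \<tau> * incidence_sgn \<sigma>2 \<tau> = c"
    if in_K: "\<sigma>1 \<in> K" "\<sigma>2 \<in> K" and nb: "down_neighbors S n (underlying \<sigma>1) (underlying \<sigma>2)"
      and \<tau>: "\<tau> \<in> oriented_simplices V S (n - 1)" "underlying \<tau> = underlying \<sigma>1 \<inter> underlying \<sigma>2"
    for \<sigma>1 \<sigma>2 \<tau>
  proof -
    obtain F G where F: "\<sigma>1 = signed_simplex F (u F)" "F \<in> X"
      and G: "\<sigma>2 = signed_simplex G (u G)" "G \<in> X"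
      using in_K by (auto simp: K_def)
    have un: "underlying \<sigma>1 = F" "underlying \<sigma>2 = G" using F G underlying_eq[OF _ u] by simp_all
    have "G \<in> nbrs F" using nb un by (simp add: nbrs_iff)
    then show ?thesis
      using incidence_product[OF _ u u \<tau>(1), of F G] nb \<tau>(2) uc[of F G] F G unfolding un by simp
  qed
  ultimately show ?thesis unfolding oriented_with_product_def by blast
qed

text \<open>\<open>u F\<close> is the sign of the orientation of \<open>F\<close> that belongs to
  \<open>K\<close>.\<close>

lemma orientation_imp_signs:
  assumes "oriented_with_product c"
  shows "\<exists>u :: 'a set \<Rightarrow> int. (\<forall>F. u F \<in> {1, -1}) \<and> (\<forall>F\<in>X. \<forall>G\<in>nbrs F. u F * u G * coupling F G = c)"
proof -
  obtain K where K: "complex_orientation V S K"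
    and prod: "\<And>\<sigma>1 \<sigma>2 \<tau>. \<lbrakk>\<sigma>1 \<in> K; \<sigma>2 \<in> K; down_neighbors S n (underlying \<sigma>1) (underlying \<sigma>2);
        \<tau> \<in> oriented_simplices V S (n - 1); underlying \<tau> = underlying \<sigma>1 \<inter> underlying \<sigma>2\<rbrakk> \<Longrightarrow>
        incidence_sgn \<sigma>1 \<tau> * incidence_sgn \<sigma>2 \<tau> = c"
    using assms unfolding oriented_with_product_def by blast
  define u :: "'a set \<Rightarrow> int" where "u F = (if signed_simplex F 1 \<in> K then 1 else -1)" for F
  have u: "u F \<in> {1, -1}" for F by (simp add: u_def)
  have in_K: "signed_simplex F (u F) \<in> K" if F: "F \<in> X" for F
  proof (cases "signed_simplex F 1 \<in> K")
    case False
    \<comment> \<open>A positive orientation outside \<open>K\<close> is the opposite of a member,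
      which must be the negative orientation of the same simplex.\<close>
    have "signed_simplex F 1 \<in> K \<union> opposite ` K"
      using K signed_simplex_in[OF F, of 1] by (simp add: complex_orientation_def)
    then obtain \<kappa> where \<kappa>: "\<kappa> \<in> K" "signed_simplex F 1 = opposite \<kappa>" using False by blast
    then have "\<kappa> \<in> oriented_simplices V S n" using K by (auto simp: complex_orientation_def)
    then obtain G e where G: "\<kappa> = signed_simplex G e" "G \<in> X" "e \<in> {1, -1}"
      using oriented_simplexE by blast
    then have "signed_simplex F 1 = signed_simplex G (- e)" using \<kappa>(2) opposite_eq[of G n e] by simp
    then have "F = G \<and> 1 = - e" using signed_simplex_eq_iff[OF F _ G(2), of 1 "- e"] G(3) by auto
    then have "e = -1" "G = F" by auto
    then show ?thesis using \<kappa>(1) G(1) False by (simp add: u_def)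
  qed (simp add: u_def)
  have "u F * u G * coupling F G = c" if F: "F \<in> X" and GF: "G \<in> nbrs F" for F G
  proof -
    have G: "G \<in> X" and nb: "down_neighbors S n F G"
      using GF nbrs_iff by (auto simp: nbrs_def)
    obtain \<mu> where \<mu>: "\<mu> \<in> oriented_simplices V S (n - 1)" "underlying \<mu> = F \<inter> G"
      using common_face_exists[OF nb] by blast
    show ?thesis
      using incidence_product[OF nb u u \<mu>] prod[OF in_K[OF F] in_K[OF G], of \<mu>] \<mu> nb
        underlying_eq[OF F u] underlying_eq[OF G u] by simp
  qed
  then show ?thesis using u by blast
qed

lemma eigenvalue_iff_oriented_with_product:
  assumes "c \<in> {1, -1::int}"
  shows "has_eigenvalue (l2_space (oriented_simplices V S n)) (down_discriminant V S n) (of_int c)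
    \<longleftrightarrow> oriented_with_product c"
proof
  assume "has_eigenvalue (l2_space (oriented_simplices V S n)) (down_discriminant V S n) (of_int c)"
  then show "oriented_with_product c"
    using eigenvalue_imp_signs[OF assms] signs_imp_orientation by blast
next
  assume "oriented_with_product c"
  then show "has_eigenvalue (l2_space (oriented_simplices V S n)) (down_discriminant V S n) (of_int c)"
    using orientation_imp_signs[of c] signs_imp_eigenvalue[where c = c] by blast
qed

end

theorem theorem5p1:
  fixes V :: "'a set" and S :: "'a set set" and n :: nat
  assumes "standing_complex V S"
    and "finite V"
    and "n = complex_dim S"
    and "card (q_simplices S n) \<ge> 2"
  shows "(has_eigenvalue (l2_space (oriented_simplices V S n)) (down_discriminant V S n) 1
            \<longleftrightarrow> totally_noncoherently_orientable V S) \<and>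
         (has_eigenvalue (l2_space (oriented_simplices V S n)) (down_discriminant V S n) (-1)
            \<longleftrightarrow> coherently_orientable V S)"
proof -
  \<comment> \<open>The vertex order is auxiliary: neither side of the equivalences refers to
    it.\<close>
  obtain sg :: "'a \<Rightarrow> 'a \<Rightarrow> int" where "sign_tournament sg"
    using sign_tournament_exists by blast
  moreover have "card (q_simplices S (complex_dim S)) \<ge> 2"
    using assms(3,4) by blast
  ultimately interpret finite_signed_complex V S sg
    using assms(1,2) by (intro finite_signed_complex.intro finite_signed_complex_axioms.intro)
  have "totally_noncoherently_orientable V S \<longleftrightarrow> oriented_with_product 1"
    "coherently_orientable V S \<longleftrightarrow> oriented_with_product (-1)"
    by (simp_all only: totally_noncoherently_orientable_def coherently_orientable_def
        oriented_with_product_def)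
  then show ?thesis
    using eigenvalue_iff_oriented_with_product[of 1] eigenvalue_iff_oriented_with_product[of "-1"]
      assms(3) by simp
qed

end
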